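(* Let $\mathbf{R}(\mathbf{u})=\mathbf{A}\mathbf{u}$ with $\mathbf{A}\in\mathbb{R}^{N\times N}$ a constant matrix (a linear time-invariant operator). If $\mathbf{A}$ is self-adjoint with all real negative eigenvalues, then $$\lambda_{A_1}\le0\quad\text{for}\quad\tau\le\frac{|\gamma_1|}{\gamma_N^2},$$ where $\gamma_1$ and $\gamma_N$ are the largest and smallest eigenvalues of $\mathbf{A}$, respectively, and $\lambda_{A_1}$ is the largest eigenvalue of $\tilde{\mathbf{V}}^T\mathbb{P}_A\mathbf{A}\tilde{\mathbf{V}}$, with $\mathbb{P}_A=\tilde{\Pi}[\mathbf{I}+\tau\mathbf{A}\Pi']$.
   Context: $N,K$ are positive integers with $K\le N$. $\tilde{\mathbf{V}}\in\mathbb{R}^{N\times K}$ is a matrix with orthonormal columns (the coarse-scale trial basis). $\tilde{\Pi}=\tilde{\mathbf{V}}\tilde{\mathbf{V}}^T$ and $\Pi'=\mathbf{I}-\tilde{\mathbf{V}}\tilde{\mathbf{V}}^T$. $\tau\ge0$ is a real constant (the memory length). "Largest" and "smallest" refer to the usual order on the real line (so $\gamma_N\le\gamma_1<0$). *)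

theory Defs
  imports "Jordan_Normal_Form.Schur_Decomposition" "Jordan_Normal_Form.Spectral_Radius"
begin

(* The library's orthogonal_mat and corthogonal_mat require the columns only to be
   pairwise orthogonal and nonzero, not to have unit length. *)
definition orthonormal_columns :: "real mat \<Rightarrow> bool" where
  "orthonormal_columns V \<longleftrightarrow>
     (\<forall>i < dim_col V. \<forall>j < dim_col V. col V i \<bullet> col V j = (if i = j then 1 else 0))"

(* Eigenvalues of a real matrix are taken over the complex numbers, so "all eigenvalues
   are real and negative" is a condition on its entire complex spectrum. *)
definition all_eigenvalues_real_negative :: "real mat \<Rightarrow> bool" where
  "all_eigenvalues_real_negative A \<longleftrightarrow>
     (\<forall>z \<in> spectrum (map_mat complex_of_real A). z \<in> \<real> \<and> Re z < 0)"

(* Largest and smallest are with respect to the order of the reals, not the modulus.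
   Max and Min are unspecified on the empty set, so any inequality proved about them
   entails that real eigenvalues exist. *)
definition largest_eigenvalue :: "real mat \<Rightarrow> real" where
  "largest_eigenvalue A = Max (spectrum A)"

definition smallest_eigenvalue :: "real mat \<Rightarrow> real" where
  "smallest_eigenvalue A = Min (spectrum A)"

definition coarse_projection :: "real mat \<Rightarrow> real mat" where
  "coarse_projection V = V * transpose_mat V"

definition fine_projection :: "real mat \<Rightarrow> real mat" where
  "fine_projection V = 1\<^sub>m (dim_row V) - V * transpose_mat V"

definition P_A :: "real mat \<Rightarrow> real mat \<Rightarrow> real \<Rightarrow> real mat" where
  "P_A A V \<tau> = coarse_projection V * (1\<^sub>m (dim_row V) + \<tau> \<cdot>\<^sub>m (A * fine_projection V))"

end

theory Submission
  imports Defs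
begin

text \<open>
Let \<open>M\<close> be the reduced operator \<open>V\<^sup>T P\<^sub>A A V\<close> and \<open>F = I - V V\<^sup>T\<close>.
Since \<open>V\<^sup>T V = I\<close>, the coarse projection inside \<open>P\<^sub>A\<close> is absorbed by \<open>V\<^sup>T\<close>, and the
quadratic form of \<open>M\<close> at \<open>y\<close>, with \<open>x = V y\<close> and \<open>a = A x\<close>, is
\<open>x \<bullet> A x + \<tau> (a \<bullet> F a)\<close> (lemma \<open>reduced_operator_form\<close>).
Subtracting the coarse part only shortens \<open>a\<close>, so \<open>a \<bullet> F a \<le> a \<bullet> a\<close>. The spectrum of
\<open>A\<close> lies in \<open>[\<gamma>\<^sub>N, \<gamma>\<^sub>1]\<close>, left of zero, so \<open>x \<bullet> A x \<le> \<gamma>\<^sub>1 (x \<bullet> x)\<close> and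
\<open>a \<bullet> a \<le> \<gamma>\<^sub>N\<^sup>2 (x \<bullet> x)\<close>. Hence the form is at most
\<open>(\<gamma>\<^sub>1 + \<tau> \<gamma>\<^sub>N\<^sup>2) (x \<bullet> x)\<close>, and the bound on \<open>\<tau>\<close> says precisely that this factor is not
positive. Evaluating the form at an eigenvector of \<open>M\<close> gives the sign of its eigenvalue.

A largest eigenvalue of \<open>M\<close> exists because the form is symmetric: \<open>M\<close> has a complex eigenvalue,
and a self-adjoint matrix has only real ones.

The two bounds on \<open>A\<close> are consequences of the spectral theorem, which is obtained here in the
form ``every vector is a sum of eigenvectors'' (lemma \<open>selfadjoint_eigen_decomp\<close>).
A triangular form \<open>B = Q A Q\<^sup>-\<^sup>1\<close>, with no orthogonality of \<open>Q\<close>, is enough: if only the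
coordinates \<open>0, \<dots>, k\<close> of \<open>Q x\<close> may be nonzero, then for \<open>Q (A - e) x\<close> with \<open>e = B\<^sub>k\<^sub>k\<close> only the
coordinates below \<open>k\<close> may be, so by induction \<open>(A - e) x\<close> is a sum of eigenvectors. Dividing its components for
\<open>l \<noteq> e\<close> by \<open>l - e\<close> and removing them from \<open>x\<close> leaves a vector \<open>w\<close> with
\<open>(A - e)\<^sup>2 w = 0\<close>, and for self-adjoint \<open>A\<close> this already forces \<open>(A - e) w = 0\<close>.
\<close>

section \<open>Self-adjoint real matrices\<close>

text \<open>Self-adjointness is used only through the bilinear form, and for the reduced operator the
form is much easier to compute than the entries of the transpose.\<close>

definition selfadjoint :: "nat \<Rightarrow> real mat \<Rightarrow> bool" where
  "selfadjoint n A \<longleftrightarrow> A \<in> carrier_mat n n \<and>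
     (\<forall>u \<in> carrier_vec n. \<forall>v \<in> carrier_vec n. (A *\<^sub>v u) \<bullet> v = u \<bullet> (A *\<^sub>v v))"

lemma selfadjoint_carrier: "selfadjoint n A \<Longrightarrow> A \<in> carrier_mat n n"
  by (simp add: selfadjoint_def)

lemma selfadjointD:
  "selfadjoint n A \<Longrightarrow> u \<in> carrier_vec n \<Longrightarrow> v \<in> carrier_vec n \<Longrightarrow>
     (A *\<^sub>v u) \<bullet> v = u \<bullet> (A *\<^sub>v v)"
  by (simp add: selfadjoint_def)

lemma scalar_prod_self_nonneg: "0 \<le> v \<bullet> (v :: real vec)"
  by (simp add: scalar_prod_def sum_nonneg)

lemma scalar_prod_self_eq_0_iff:
  fixes v :: "real vec"
  assumes "v \<in> carrier_vec n"
  shows "v \<bullet> v = 0 \<longleftrightarrow> v = 0\<^sub>v n"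
  using conjugate_square_eq_0_vec[OF assms] by simp

lemma transpose_mult_vec_scalar_prod:
  fixes C :: "real mat"
  assumes C: "C \<in> carrier_mat n m" and u: "u \<in> carrier_vec n" and v: "v \<in> carrier_vec m"
  shows "(transpose_mat C *\<^sub>v u) \<bullet> v = u \<bullet> (C *\<^sub>v v)"
proof -
  have "transpose_mat C *\<^sub>v u = vec m (\<lambda>j. u \<bullet> col C j)"
    using C u by (auto intro!: eq_vecI simp: comm_scalar_prod[of _ n])
  moreover have "C *\<^sub>v v = vec n (\<lambda>i. row C i \<bullet> v)"
    using C by (auto intro!: eq_vecI)
  ultimately show ?thesis using assoc_scalar_prod[OF u C v] by simp
qed

lemma selfadjoint_if_mat_adjoint_eq:
  assumes A: "A \<in> carrier_mat n n" and adj: "mat_adjoint A = A"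
  shows "selfadjoint n A"
proof -
  have "mat_adjoint A = transpose_mat A"
    using A by (auto intro!: eq_matI simp: mat_adjoint_def mat_of_rows_def)
  with adj have "transpose_mat A = A" by simp
  then show ?thesis
    using transpose_mult_vec_scalar_prod[OF A] A unfolding selfadjoint_def by simp
qed

text \<open>Writing a complex eigenvector as \<open>a + \<i> b\<close> keeps everything in the real form: comparing
\<open>A a \<bullet> b\<close> with \<open>a \<bullet> A b\<close> leaves \<open>Im z\<close> times \<open>a \<bullet> a + b \<bullet> b\<close> equal to zero.\<close>

lemma selfadjoint_complex_eigenvalue_real:
  assumes sa: "selfadjoint n A" and ev: "eigenvalue (map_mat complex_of_real A) z"
  shows "z \<in> \<real>"
proof -
  note A = selfadjoint_carrier[OF sa]
  let ?A = "map_mat complex_of_real A"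
  obtain v where v: "v \<in> carrier_vec n" "v \<noteq> 0\<^sub>v n" "?A *\<^sub>v v = z \<cdot>\<^sub>v v"
    using ev A unfolding eigenvalue_def eigenvector_def by auto
  define a where "a = map_vec Re v"
  define b where "b = map_vec Im v"
  have a: "a \<in> carrier_vec n" and b: "b \<in> carrier_vec n" using v by (auto simp: a_def b_def)
  have comp: "(?A *\<^sub>v v) $ i = z * v $ i" if "i < n" for i using v that by simp
  have Aa: "A *\<^sub>v a = Re z \<cdot>\<^sub>v a - Im z \<cdot>\<^sub>v b"
  proof (rule eq_vecI)
    fix i assume "i < dim_vec (Re z \<cdot>\<^sub>v a - Im z \<cdot>\<^sub>v b)"
    then have i: "i < n" using b by simp
    have "(A *\<^sub>v a) $ i = Re ((?A *\<^sub>v v) $ i)"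
      using A v(1) i by (simp add: scalar_prod_def a_def)
    then show "(A *\<^sub>v a) $ i = (Re z \<cdot>\<^sub>v a - Im z \<cdot>\<^sub>v b) $ i"
      using comp[OF i] v(1) i a b by (simp add: a_def b_def)
  qed (use A b in auto)
  have Ab: "A *\<^sub>v b = Im z \<cdot>\<^sub>v a + Re z \<cdot>\<^sub>v b"
  proof (rule eq_vecI)
    fix i assume "i < dim_vec (Im z \<cdot>\<^sub>v a + Re z \<cdot>\<^sub>v b)"
    then have i: "i < n" using b by simp
    have "(A *\<^sub>v b) $ i = Im ((?A *\<^sub>v v) $ i)"
      using A v(1) i by (simp add: scalar_prod_def b_def)
    then show "(A *\<^sub>v b) $ i = (Im z \<cdot>\<^sub>v a + Re z \<cdot>\<^sub>v b) $ i"
      using comp[OF i] v(1) i a b by (simp add: a_def b_def)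
  qed (use A b in auto)
  have "(A *\<^sub>v a) \<bullet> b = a \<bullet> (A *\<^sub>v b)" by (rule selfadjointD[OF sa a b])
  moreover have "(A *\<^sub>v a) \<bullet> b = Re z * (a \<bullet> b) - Im z * (b \<bullet> b)"
    unfolding Aa using a b by (subst minus_scalar_prod_distrib[of _ n]) auto
  moreover have "a \<bullet> (A *\<^sub>v b) = Im z * (a \<bullet> a) + Re z * (a \<bullet> b)"
    unfolding Ab using a b by (subst scalar_prod_add_distrib[of _ n]) auto
  ultimately have "Im z * (a \<bullet> a + b \<bullet> b) = 0" by (simp add: algebra_simps)
  moreover have "a \<bullet> a + b \<bullet> b \<noteq> 0"
  proof
    assume "a \<bullet> a + b \<bullet> b = 0"
    with scalar_prod_self_nonneg[of a] scalar_prod_self_nonneg[of b]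
    have "a \<bullet> a = 0" "b \<bullet> b = 0" by linarith+
    then have z: "a = 0\<^sub>v n" "b = 0\<^sub>v n"
      using a b scalar_prod_self_eq_0_iff by blast+
    have "v $ i = 0" if "i < n" for i
    proof (rule complex_eqI)
      show "Re (v $ i) = Re 0" using arg_cong[OF z(1), of "\<lambda>w. w $ i"] that v by (simp add: a_def)
      show "Im (v $ i) = Im 0" using arg_cong[OF z(2), of "\<lambda>w. w $ i"] that v by (simp add: b_def)
    qed
    then have "v = 0\<^sub>v n" using v by (intro eq_vecI) auto
    with v show False by simp
  qed
  ultimately show ?thesis by (simp add: complex_is_Real_iff)
qed

text \<open>The complex roots are real, and embedding real polynomials into complex ones is injective, so
the factorization over \<open>\<complex>\<close> descends to \<open>\<real>\<close>.\<close>

lemma selfadjoint_char_poly_splits: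
  assumes sa: "selfadjoint n A"
  obtains es :: "real list" where "char_poly A = (\<Prod>e\<leftarrow>es. [:- e, 1:])" "length es = n"
proof -
  note A = selfadjoint_carrier[OF sa]
  let ?A = "map_mat complex_of_real A"
  have A': "?A \<in> carrier_mat n n" using A by simp
  obtain zs where zs: "char_poly ?A = (\<Prod>z\<leftarrow>zs. [:- z, 1:])" "length zs = n"
    using char_poly_factorized[OF A'] by auto
  have real: "complex_of_real (Re z) = z" if "z \<in> set zs" for z
  proof -
    have "poly (char_poly ?A) z = 0"
      using that unfolding zs(1) by (auto simp: poly_prod_list prod_list_zero_iff image_iff o_def)
    then show ?thesis
      using selfadjoint_complex_eigenvalue_real[OF sa] eigenvalue_root_char_poly[OF A'] of_real_Re
      by blast
  qed
  interpret h: map_poly_inj_idom_hom complex_of_real ..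
  have "map_poly complex_of_real (char_poly A) = char_poly ?A"
    by (rule of_real_hom.char_poly_hom[OF A, symmetric])
  also have "\<dots> = map_poly complex_of_real (\<Prod>e\<leftarrow>map Re zs. [:- e, 1:])"
    unfolding zs(1) h.hom_prod_list map_map using real
    by (intro arg_cong[of _ _ prod_list] map_cong) auto
  finally have "char_poly A = (\<Prod>e\<leftarrow>map Re zs. [:- e, 1:])" by (rule h.injectivity)
  then show thesis using that[of "map Re zs"] zs(2) by simp
qed

lemma selfadjoint_spectrum_nonempty:
  assumes sa: "selfadjoint n A" and "0 < n"
  shows "spectrum A \<noteq> {}"
proof -
  obtain es where es: "char_poly A = (\<Prod>e\<leftarrow>es. [:- e, 1:])" "length es = n"
    using selfadjoint_char_poly_splits[OF sa] .
  then obtain e where "e \<in> set es" using \<open>0 < n\<close> by (cases es) auto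
  then have "poly (char_poly A) e = 0"
    unfolding es(1) by (auto simp: poly_prod_list prod_list_zero_iff image_iff o_def)
  then show ?thesis using spectrum_root_char_poly[OF selfadjoint_carrier[OF sa]] by auto
qed

section \<open>Decomposition into eigenvectors\<close>

text \<open>Vectors of this type carry their dimension and do not form an additive monoid, so a sum over a
set is taken coordinatewise in a given dimension.\<close>

definition vec_sum :: "nat \<Rightarrow> real set \<Rightarrow> (real \<Rightarrow> real vec) \<Rightarrow> real vec" where
  "vec_sum n S f = vec n (\<lambda>i. \<Sum>l\<in>S. f l $ i)"

lemma vec_sum_carrier [simp]: "vec_sum n S f \<in> carrier_vec n"
  by (simp add: vec_sum_def)

lemma vec_sum_scalar_prod:
  assumes "v \<in> carrier_vec n"
  shows "vec_sum n S f \<bullet> v = (\<Sum>l\<in>S. f l \<bullet> v)"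
  using assms by (auto simp: vec_sum_def scalar_prod_def sum_distrib_right intro: sum.swap)

lemma mult_mat_vec_sum:
  assumes A: "A \<in> carrier_mat n n" and f: "\<And>l. l \<in> S \<Longrightarrow> f l \<in> carrier_vec n"
  shows "A *\<^sub>v vec_sum n S f = vec_sum n S (\<lambda>l. A *\<^sub>v f l)"
proof (rule eq_vecI)
  fix i assume "i < dim_vec (vec_sum n S (\<lambda>l. A *\<^sub>v f l))"
  then have i: "i < n" by (simp add: vec_sum_def)
  have "(A *\<^sub>v vec_sum n S f) $ i = vec_sum n S f \<bullet> row A i"
    using A i by (simp add: comm_scalar_prod[of _ n])
  also have "\<dots> = (\<Sum>l\<in>S. f l \<bullet> row A i)" using A i by (intro vec_sum_scalar_prod) auto
  also have "\<dots> = vec_sum n S (\<lambda>l. A *\<^sub>v f l) $ i"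
    using A i f by (auto simp: vec_sum_def comm_scalar_prod[of _ n] intro!: sum.cong)
  finally show "(A *\<^sub>v vec_sum n S f) $ i = vec_sum n S (\<lambda>l. A *\<^sub>v f l) $ i" .
qed (use A in \<open>simp add: vec_sum_def\<close>)

text \<open>The zero vector is admitted as a component, so that one family indexed by the whole spectrum
serves for every vector.\<close>

definition eigen_decomp :: "nat \<Rightarrow> real mat \<Rightarrow> (real \<Rightarrow> real vec) \<Rightarrow> real vec \<Rightarrow> bool" where
  "eigen_decomp n A f x \<longleftrightarrow> x = vec_sum n (spectrum A) f \<and>
     (\<forall>l \<in> spectrum A. f l \<in> carrier_vec n \<and> A *\<^sub>v f l = l \<cdot>\<^sub>v f l)"

text \<open>Solving \<open>(A - e) x = y\<close> for a decomposed \<open>y\<close>: the components of \<open>y\<close> for eigenvalues other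
than \<open>e\<close> can be divided by \<open>l - e\<close>. The remaining component \<open>f e\<close> is both in the kernel and in
the range of the self-adjoint \<open>A - e\<close>; these are orthogonal, so it vanishes.\<close>

lemma eigen_decomp_extend:
  assumes sa: "selfadjoint n A" and e: "e \<in> spectrum A" and x: "x \<in> carrier_vec n"
    and dec: "eigen_decomp n A f (A *\<^sub>v x - e \<cdot>\<^sub>v x)"
  shows "\<exists>g. eigen_decomp n A g x"
proof -
  note A = selfadjoint_carrier[OF sa]
  let ?E = "spectrum A"
  have fin: "finite ?E" using card_finite_spectrum[OF A] by simp
  have f: "f l \<in> carrier_vec n" and Af: "A *\<^sub>v f l = l \<cdot>\<^sub>v f l" if "l \<in> ?E" for l
    using dec that by (auto simp: eigen_decomp_def)
  have y: "A *\<^sub>v x - e \<cdot>\<^sub>v x = vec_sum n ?E f" using dec by (simp add: eigen_decomp_def)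
  define h where "h l = (1 / (l - e)) \<cdot>\<^sub>v f l" for l
  have h: "h l \<in> carrier_vec n" and Ah: "A *\<^sub>v h l = l \<cdot>\<^sub>v h l" if "l \<in> ?E" for l
    using f[OF that] Af[OF that] mult_mat_vec[OF A f[OF that]]
    by (auto simp: h_def smult_smult_assoc mult.commute)
  define z where "z = vec_sum n (?E - {e}) h"
  define w where "w = x - z"
  have z: "z \<in> carrier_vec n" and w: "w \<in> carrier_vec n" using x by (simp_all add: z_def w_def)
  have Az: "A *\<^sub>v z = vec_sum n (?E - {e}) (\<lambda>l. l \<cdot>\<^sub>v h l)"
    unfolding z_def using A h Ah by (subst mult_mat_vec_sum) (auto simp: vec_sum_def intro!: eq_vecI)
  have Aw: "A *\<^sub>v w = e \<cdot>\<^sub>v w + f e"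
  proof (rule eq_vecI)
    fix i assume "i < dim_vec (e \<cdot>\<^sub>v w + f e)"
    then have i: "i < n" using f[OF e] by simp
    have "(A *\<^sub>v x) $ i - e * x $ i = (\<Sum>l\<in>?E. f l $ i)"
      using arg_cong[OF y, of "\<lambda>v. v $ i"] x A i by (simp add: vec_sum_def)
    also have "\<dots> = f e $ i + (\<Sum>l\<in>?E - {e}. f l $ i)" using fin e by (rule sum.remove)
    also have "(\<Sum>l\<in>?E - {e}. f l $ i) = (\<Sum>l\<in>?E - {e}. (l - e) * h l $ i)"
  proof (rule sum.cong[OF refl])
      fix l assume "l \<in> ?E - {e}"
      then show "f l $ i = (l - e) * h l $ i" using f[of l] i by (simp add: h_def)
    qed
    also have "\<dots> = (A *\<^sub>v z) $ i - e * z $ i"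
    proof -
      have "(\<Sum>l\<in>?E - {e}. (l \<cdot>\<^sub>v h l) $ i) = (\<Sum>l\<in>?E - {e}. l * h l $ i)"
      proof (rule sum.cong[OF refl])
        fix l assume "l \<in> ?E - {e}"
        then show "(l \<cdot>\<^sub>v h l) $ i = l * h l $ i" using h[of l] i by simp
      qed
      then show ?thesis
        unfolding Az using i
        by (simp add: z_def vec_sum_def algebra_simps sum_subtractf sum_distrib_left)
    qed
    finally show "(A *\<^sub>v w) $ i = (e \<cdot>\<^sub>v w + f e) $ i"
      unfolding w_def mult_minus_distrib_mat_vec[OF A x z] using A x z i f[OF e]
      by (simp add: algebra_simps)
  qed (use A f[OF e] in auto)
  \<comment> \<open>\<open>f e = (A - e) w\<close> is orthogonal to the kernel of \<open>A - e\<close>, hence to itself.\<close>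
  have "(A *\<^sub>v w) \<bullet> f e = w \<bullet> (A *\<^sub>v f e)" by (rule selfadjointD[OF sa w f[OF e]])
  then have "f e \<bullet> f e = 0"
    unfolding Aw Af[OF e] using w f[OF e] by (subst (asm) add_scalar_prod_distrib[of _ n]) auto
  then have "f e = 0\<^sub>v n" using f[OF e] scalar_prod_self_eq_0_iff by blast
  then have Aw': "A *\<^sub>v w = e \<cdot>\<^sub>v w" using Aw w by simp
  define g where "g = h(e := w)"
  have "x = vec_sum n ?E g"
  proof (rule eq_vecI)
    fix i assume "i < dim_vec (vec_sum n ?E g)"
    then have i: "i < n" by (simp add: vec_sum_def)
    have "(\<Sum>l\<in>?E. g l $ i) = g e $ i + (\<Sum>l\<in>?E - {e}. g l $ i)" using fin e by (rule sum.remove)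
    also have "(\<Sum>l\<in>?E - {e}. g l $ i) = z $ i"
      using i unfolding z_def vec_sum_def by (auto simp: g_def intro!: sum.cong)
    finally show "x $ i = vec_sum n ?E g $ i"
      using i x z by (simp add: vec_sum_def g_def w_def)
  qed (use x in \<open>simp add: vec_sum_def\<close>)
  moreover have "g l \<in> carrier_vec n \<and> A *\<^sub>v g l = l \<cdot>\<^sub>v g l" if "l \<in> ?E" for l
    using h[OF that] Ah[OF that] w Aw' by (auto simp: g_def)
  ultimately show ?thesis unfolding eigen_decomp_def by blast
qed

text \<open>The spectral theorem, by induction along the flag of invariant subspaces that a triangular form
provides. The diagonal entries of the triangular form are the eigenvalues used in the
induction steps.\<close>

lemma selfadjoint_eigen_decomp:
  assumes sa: "selfadjoint n A" and x: "x \<in> carrier_vec n"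
  shows "\<exists>f. eigen_decomp n A f x"
proof -
  note A = selfadjoint_carrier[OF sa]
  obtain es where es: "char_poly A = (\<Prod>e\<leftarrow>es. [:- e, 1:])"
    using selfadjoint_char_poly_splits[OF sa] .
  obtain B P Q where BPQ: "schur_decomposition A es = (B, P, Q)"
    by (cases "schur_decomposition A es") auto
  from schur_decomposition[OF A es BPQ]
  have sim: "similar_mat_wit A B P Q" and ut: "upper_triangular B" and diag: "diag_mat B = es"
    by auto
  have dims: "dim_row A = n" "dim_col A = n" "dim_row B = n" "dim_col B = n"
    "dim_row P = n" "dim_col P = n" "dim_row Q = n" "dim_col Q = n"
    using similar_mat_witD2(4-7)[OF A sim] by auto
  note [simp] = similar_mat_witD2(5-7)[OF A sim]
  note inv = similar_mat_witD2(1-3)[OF A sim]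
  have QA: "Q * A = B * Q"
  proof -
    have "Q * A = Q * (P * B) * Q"
      unfolding inv(3) using similar_mat_witD2(5-7)[OF A sim]
      by (intro assoc_mult_mat[symmetric, of _ n n _ n _ n] mult_carrier_mat)
    also have "Q * (P * B) = (Q * P) * B"
      using similar_mat_witD2(5-7)[OF A sim] by (intro assoc_mult_mat[symmetric, of _ n n _ n _ n])
    finally show ?thesis using inv(2) by (simp add: left_mult_one_mat[of _ n n])
  qed
  have eig: "B $$ (k, k) \<in> spectrum A" if "k < n" for k
  proof -
    have "B $$ (k, k) \<in> set es" using that dims by (auto simp: diag[symmetric] diag_mat_def)
    then show ?thesis
      unfolding spectrum_root_char_poly[OF A] es
      by (auto simp: poly_prod_list prod_list_zero_iff image_iff o_def)
  qed
  have "\<exists>f. eigen_decomp n A f x"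
    if "k \<le> n" "x \<in> carrier_vec n" "\<And>i. k \<le> i \<Longrightarrow> i < n \<Longrightarrow> (Q *\<^sub>v x) $ i = 0" for k x
    using that
  proof (induction k arbitrary: x)
    case 0
    have "Q *\<^sub>v x = 0\<^sub>v n" using 0 dims by (intro eq_vecI) auto
    then have "P *\<^sub>v (Q *\<^sub>v x) = 0\<^sub>v n" by (auto intro!: eq_vecI simp: scalar_prod_def dims)
    then have "x = 0\<^sub>v n"
      using 0 inv(1) assoc_mult_mat_vec[of P n n Q n x] by simp
    then have "eigen_decomp n A (\<lambda>_. 0\<^sub>v n) x"
      unfolding eigen_decomp_def
      by (auto intro!: eq_vecI simp: vec_sum_def scalar_prod_def dims)
    then show ?case by blast
  next
    case (Suc k)
    define e where "e = B $$ (k, k)"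
    define y where "y = A *\<^sub>v x - e \<cdot>\<^sub>v x"
    note x = Suc.prems(2)
    have k: "k < n" using Suc.prems by simp
    have y: "y \<in> carrier_vec n" using A x by (simp add: y_def)
    have Qx: "Q *\<^sub>v x \<in> carrier_vec n" using similar_mat_witD2(7)[OF A sim] x by (rule mult_mat_vec_carrier)
    have Qy: "Q *\<^sub>v y = B *\<^sub>v (Q *\<^sub>v x) - e \<cdot>\<^sub>v (Q *\<^sub>v x)"
    proof -
      have "Q *\<^sub>v y = Q *\<^sub>v (A *\<^sub>v x) - Q *\<^sub>v (e \<cdot>\<^sub>v x)"
        unfolding y_def using A x by (intro mult_minus_distrib_mat_vec[of _ n n]) auto
      also have "Q *\<^sub>v (A *\<^sub>v x) = (Q * A) *\<^sub>v x"
        using A x by (intro assoc_mult_mat_vec[symmetric, of _ n n _ n]) auto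
      also have "\<dots> = B *\<^sub>v (Q *\<^sub>v x)"
        unfolding QA using x by (intro assoc_mult_mat_vec[of _ n n _ n]) auto
      also have "Q *\<^sub>v (e \<cdot>\<^sub>v x) = e \<cdot>\<^sub>v (Q *\<^sub>v x)"
        using x by (intro mult_mat_vec[of _ n n]) auto
      finally show ?thesis .
    qed
    \<comment> \<open>For \<open>i > k\<close> row \<open>i\<close> of \<open>B\<close> meets only vanishing coordinates of \<open>Q x\<close>; for \<open>i = k\<close> the one
      surviving term is the diagonal one, and it is cancelled by \<open>e\<close>.\<close>
    have "(Q *\<^sub>v y) $ i = 0" if "k \<le> i" "i < n" for i
    proof -
      have "(B *\<^sub>v (Q *\<^sub>v x)) $ i = (\<Sum>j<n. B $$ (i, j) * (Q *\<^sub>v x) $ j)"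
        using that dims Qx by (simp add: scalar_prod_def lessThan_atLeast0)
      also have "\<dots> = (\<Sum>j<n. if j = i then e * (Q *\<^sub>v x) $ i else 0)"
      proof (rule sum.cong[OF refl])
        fix j assume "j \<in> {..<n}"
        then have below: "B $$ (i, j) = 0" if "j < i"
          using ut that \<open>i < n\<close> dims unfolding upper_triangular_def by simp
        have beyond: "(Q *\<^sub>v x) $ j = 0" if "k < j"
          using Suc.prems(3) that \<open>j \<in> {..<n}\<close> by simp
        consider "j < i" | "k < j" | "j = i" "i = k" using \<open>k \<le> i\<close> by linarith
        then show "B $$ (i, j) * (Q *\<^sub>v x) $ j = (if j = i then e * (Q *\<^sub>v x) $ i else 0)"
          by cases (use below beyond in \<open>auto simp: e_def\<close>)
      qed
      also have "\<dots> = e * (Q *\<^sub>v x) $ i" using that by simp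
      finally show ?thesis unfolding Qy using that dims by simp
    qed
    then obtain f where "eigen_decomp n A f y" using Suc.IH[OF _ y] k by auto
    then show ?case
      using eigen_decomp_extend[OF sa _ x] eig[OF k] unfolding y_def e_def by blast
  qed
  from this[of n x] x show ?thesis by simp
qed

text \<open>The weights are the squared lengths of the eigenvector components, that is, the spectral measure
of \<open>x\<close>; the cross terms vanish since eigenvectors of distinct eigenvalues are orthogonal.
Estimates for quadratic forms thereby become estimates on the spectrum.\<close>

lemma selfadjoint_spectral_weights:
  assumes sa: "selfadjoint n A" and x: "x \<in> carrier_vec n"
  obtains c :: "real \<Rightarrow> real" where "\<And>l. 0 \<le> c l"
    "x \<bullet> x = (\<Sum>l\<in>spectrum A. c l)"
    "x \<bullet> (A *\<^sub>v x) = (\<Sum>l\<in>spectrum A. l * c l)"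
    "(A *\<^sub>v x) \<bullet> (A *\<^sub>v x) = (\<Sum>l\<in>spectrum A. l\<^sup>2 * c l)"
proof -
  note A = selfadjoint_carrier[OF sa]
  let ?E = "spectrum A"
  have fin: "finite ?E" using card_finite_spectrum[OF A] by simp
  obtain f where dec: "eigen_decomp n A f x" using selfadjoint_eigen_decomp[OF sa x] by blast
  then have f: "f l \<in> carrier_vec n" and Af: "A *\<^sub>v f l = l \<cdot>\<^sub>v f l" if "l \<in> ?E" for l
    using that by (auto simp: eigen_decomp_def)
  have xf: "x = vec_sum n ?E f" using dec by (simp add: eigen_decomp_def)
  have orth: "f l \<bullet> f m = 0" if "l \<in> ?E" "m \<in> ?E" "l \<noteq> m" for l m
    using selfadjointD[OF sa f f, OF that(1,2)] that f[OF that(1)] f[OF that(2)] by (simp add: Af)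
  have fx: "f l \<bullet> x = f l \<bullet> f l" if l: "l \<in> ?E" for l
  proof -
    have "f l \<bullet> x = (\<Sum>m\<in>?E. f m \<bullet> f l)"
      using vec_sum_scalar_prod[OF f[OF l], of ?E f] comm_scalar_prod[OF f[OF l] x] xf by simp
    also have "\<dots> = (\<Sum>m\<in>?E. if m = l then f l \<bullet> f l else 0)"
      using orth l by (intro sum.cong) auto
    finally show ?thesis using l fin by simp
  qed
  have fAx: "f l \<bullet> (A *\<^sub>v x) = l * (f l \<bullet> f l)" if l: "l \<in> ?E" for l
    using selfadjointD[OF sa f[OF l] x] f[OF l] x fx[OF l] by (simp add: Af[OF l])
  have Ax: "A *\<^sub>v x \<in> carrier_vec n" using A x by simp
  show thesis
  proof (rule that[of "\<lambda>l. f l \<bullet> f l"])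
    show "x \<bullet> x = (\<Sum>l\<in>?E. f l \<bullet> f l)"
      using vec_sum_scalar_prod[OF x, of ?E f] fx xf by simp
    show "x \<bullet> (A *\<^sub>v x) = (\<Sum>l\<in>?E. l * (f l \<bullet> f l))"
      using vec_sum_scalar_prod[OF Ax, of ?E f] fAx xf by simp
    have "A *\<^sub>v x = vec_sum n ?E (\<lambda>l. A *\<^sub>v f l)"
      using mult_mat_vec_sum[OF A f] xf by simp
    then have "(A *\<^sub>v x) \<bullet> (A *\<^sub>v x) = (\<Sum>l\<in>?E. (A *\<^sub>v f l) \<bullet> (A *\<^sub>v x))"
      using vec_sum_scalar_prod[OF Ax, of ?E "\<lambda>l. A *\<^sub>v f l"] by simp
    also have "\<dots> = (\<Sum>l\<in>?E. l\<^sup>2 * (f l \<bullet> f l))"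
    proof (rule sum.cong[OF refl])
      fix l assume l: "l \<in> ?E"
      show "(A *\<^sub>v f l) \<bullet> (A *\<^sub>v x) = l\<^sup>2 * (f l \<bullet> f l)"
        unfolding Af[OF l] smult_scalar_prod_distrib[OF f[OF l] Ax] fAx[OF l]
        by (simp add: power2_eq_square)
    qed
    finally show "(A *\<^sub>v x) \<bullet> (A *\<^sub>v x) = (\<Sum>l\<in>?E. l\<^sup>2 * (f l \<bullet> f l))" .
  qed (rule scalar_prod_self_nonneg)
qed

lemma selfadjoint_rayleigh_le:
  assumes sa: "selfadjoint n A" and x: "x \<in> carrier_vec n"
    and b: "\<And>l. l \<in> spectrum A \<Longrightarrow> l \<le> b"
  shows "x \<bullet> (A *\<^sub>v x) \<le> b * (x \<bullet> x)"
proof -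
  obtain c where "\<And>l. 0 \<le> c l" "x \<bullet> x = (\<Sum>l\<in>spectrum A. c l)"
    "x \<bullet> (A *\<^sub>v x) = (\<Sum>l\<in>spectrum A. l * c l)"
    using selfadjoint_spectral_weights[OF sa x] by blast
  then show ?thesis using b by (auto simp: sum_distrib_left intro!: sum_mono mult_right_mono)
qed

lemma selfadjoint_norm_sq_le:
  assumes sa: "selfadjoint n A" and x: "x \<in> carrier_vec n"
    and b: "\<And>l. l \<in> spectrum A \<Longrightarrow> l\<^sup>2 \<le> b"
  shows "(A *\<^sub>v x) \<bullet> (A *\<^sub>v x) \<le> b * (x \<bullet> x)"
proof -
  obtain c where "\<And>l. 0 \<le> c l" "x \<bullet> x = (\<Sum>l\<in>spectrum A. c l)"
    "(A *\<^sub>v x) \<bullet> (A *\<^sub>v x) = (\<Sum>l\<in>spectrum A. l\<^sup>2 * c l)"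
    using selfadjoint_spectral_weights[OF sa x] by blast
  then show ?thesis using b by (auto simp: sum_distrib_left intro!: sum_mono mult_right_mono)
qed

section \<open>The reduced operator\<close>

lemma orthonormal_columns_transpose_mult_self:
  assumes V: "V \<in> carrier_mat n k" and orth: "orthonormal_columns V"
  shows "transpose_mat V * V = 1\<^sub>m k"
  using V orth by (auto intro!: eq_matI simp: orthonormal_columns_def)

lemma fine_projection_mult_vec:
  assumes V: "V \<in> carrier_mat n k" and a: "a \<in> carrier_vec n"
  shows "fine_projection V *\<^sub>v a = a - V *\<^sub>v (transpose_mat V *\<^sub>v a)"
proof -
  have "fine_projection V *\<^sub>v a = 1\<^sub>m n *\<^sub>v a - (V * transpose_mat V) *\<^sub>v a"
    using V a unfolding fine_projection_def
    by (simp add: minus_mult_distrib_mat_vec[of _ n n])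
  also have "(V * transpose_mat V) *\<^sub>v a = V *\<^sub>v (transpose_mat V *\<^sub>v a)"
    using V a by (intro assoc_mult_mat_vec[of _ n k _ n]) auto
  finally show ?thesis using a by simp
qed

text \<open>This form gives at once the symmetry of the fine projection and, for \<open>a = b\<close>, the bound of its
quadratic form by \<open>a \<bullet> a\<close>.\<close>

lemma scalar_prod_fine_projection:
  assumes V: "V \<in> carrier_mat n k" and a: "a \<in> carrier_vec n" and b: "b \<in> carrier_vec n"
  shows "a \<bullet> (fine_projection V *\<^sub>v b) =
    a \<bullet> b - (transpose_mat V *\<^sub>v a) \<bullet> (transpose_mat V *\<^sub>v b)"
proof -
  have Vb: "transpose_mat V *\<^sub>v b \<in> carrier_vec k" using V b by simp
  have VVb: "V *\<^sub>v (transpose_mat V *\<^sub>v b) \<in> carrier_vec n" using V Vb by simp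
  show ?thesis
    unfolding fine_projection_mult_vec[OF V b] scalar_prod_minus_distrib[OF a b VVb]
    by (simp add: transpose_mult_vec_scalar_prod[OF V a Vb])
qed

abbreviation reduced_operator :: "real mat \<Rightarrow> real mat \<Rightarrow> real \<Rightarrow> real mat" where
  "reduced_operator A V \<tau> \<equiv> transpose_mat V * P_A A V \<tau> * A * V"

text \<open>By \<open>V\<^sup>T V = I\<close> the factor \<open>V\<^sup>T V V\<^sup>T\<close> collapses to \<open>V\<^sup>T\<close>; moving \<open>V\<^sup>T\<close> and one \<open>A\<close> to the
other side of the scalar product then makes the form visibly symmetric in \<open>y\<close> and \<open>w\<close>.\<close>

lemma reduced_operator_form:
  assumes sa: "selfadjoint n A" and V: "V \<in> carrier_mat n k" and orth: "orthonormal_columns V"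
    and y: "y \<in> carrier_vec k" and w: "w \<in> carrier_vec k"
  shows "y \<bullet> (reduced_operator A V \<tau> *\<^sub>v w) =
    (V *\<^sub>v y) \<bullet> (A *\<^sub>v (V *\<^sub>v w)) +
    \<tau> * ((A *\<^sub>v (V *\<^sub>v y)) \<bullet> (fine_projection V *\<^sub>v (A *\<^sub>v (V *\<^sub>v w))))"
proof -
  note A = selfadjoint_carrier[OF sa]
  let ?T = "transpose_mat V" and ?F = "fine_projection V"
  define a where "a = A *\<^sub>v (V *\<^sub>v w)"
  have F: "?F \<in> carrier_mat n n" using V by (auto simp: fine_projection_def)
  have T: "?T \<in> carrier_mat k n" using V by simp
  have Vy: "V *\<^sub>v y \<in> carrier_vec n" and Vw: "V *\<^sub>v w \<in> carrier_vec n" using V y w by simp_all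
  have a: "a \<in> carrier_vec n" using A Vw by (simp add: a_def)
  have Fa: "?F *\<^sub>v a \<in> carrier_vec n" using F a by simp
  have AFa: "A *\<^sub>v (?F *\<^sub>v a) \<in> carrier_vec n" using A Fa by simp
  define C where "C = 1\<^sub>m n + \<tau> \<cdot>\<^sub>m (A * ?F)"
  have C: "C \<in> carrier_mat n n" using A F by (simp add: C_def)
  have Ca: "C *\<^sub>v a = a + \<tau> \<cdot>\<^sub>v (A *\<^sub>v (?F *\<^sub>v a))"
  proof -
    have "C *\<^sub>v a = 1\<^sub>m n *\<^sub>v a + (\<tau> \<cdot>\<^sub>m (A * ?F)) *\<^sub>v a"
      unfolding C_def using A F a by (intro add_mult_distrib_mat_vec[of _ n n]) auto
    also have "(\<tau> \<cdot>\<^sub>m (A * ?F)) *\<^sub>v a = \<tau> \<cdot>\<^sub>v ((A * ?F) *\<^sub>v a)"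
      using A F a
      by (intro eq_vecI)
        (simp_all add: assoc_mult_mat_vec[of _ n n _ n, symmetric] del: assoc_mult_mat_vec)
    finally show ?thesis using A F a by (simp add: assoc_mult_mat_vec[of _ n n _ n])
  qed
  have VT: "V * ?T \<in> carrier_mat n n" using V T by simp
  have "P_A A V \<tau> = V * ?T * C"
    using V by (simp add: P_A_def coarse_projection_def C_def)
  then have "?T * P_A A V \<tau> = ?T * (V * ?T) * C"
    by (simp add: assoc_mult_mat[OF T VT C])
  also have "?T * (V * ?T) = (?T * V) * ?T"
    by (simp add: assoc_mult_mat[OF T V T])
  also have "?T * V * ?T = ?T"
    by (simp add: orthonormal_columns_transpose_mult_self[OF V orth] left_mult_one_mat[OF T])
  finally have "reduced_operator A V \<tau> *\<^sub>v w = (?T * C * A * V) *\<^sub>v w" by simp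
  also have "\<dots> = (?T * C * A) *\<^sub>v (V *\<^sub>v w)"
    using T C A V w by (intro assoc_mult_mat_vec[of _ k n _ k] mult_carrier_mat)
  also have "\<dots> = (?T * C) *\<^sub>v a"
    unfolding a_def using T C A Vw by (intro assoc_mult_mat_vec[of _ k n _ n] mult_carrier_mat)
  also have "\<dots> = ?T *\<^sub>v (C *\<^sub>v a)" by (rule assoc_mult_mat_vec[OF T C a])
  finally have Mw: "reduced_operator A V \<tau> *\<^sub>v w = ?T *\<^sub>v (C *\<^sub>v a)" .
  have Ca': "C *\<^sub>v a \<in> carrier_vec n" using C a by (rule mult_mat_vec_carrier)
  have "y \<bullet> (reduced_operator A V \<tau> *\<^sub>v w) = (?T *\<^sub>v (C *\<^sub>v a)) \<bullet> y"
    unfolding Mw using y mult_mat_vec_carrier[OF T Ca'] by (rule comm_scalar_prod)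
  also have "\<dots> = (C *\<^sub>v a) \<bullet> (V *\<^sub>v y)" by (rule transpose_mult_vec_scalar_prod[OF V Ca' y])
  also have "\<dots> = (V *\<^sub>v y) \<bullet> (C *\<^sub>v a)" by (rule comm_scalar_prod[OF Ca' Vy])
  also have "\<dots> = (V *\<^sub>v y) \<bullet> a + \<tau> * ((V *\<^sub>v y) \<bullet> (A *\<^sub>v (?F *\<^sub>v a)))"
    unfolding Ca using Vy a AFa by (subst scalar_prod_add_distrib[of _ n]) auto
  also have "(V *\<^sub>v y) \<bullet> (A *\<^sub>v (?F *\<^sub>v a)) = (A *\<^sub>v (V *\<^sub>v y)) \<bullet> (?F *\<^sub>v a)"
    by (rule selfadjointD[OF sa Vy Fa, symmetric])
  finally show ?thesis by (simp add: a_def)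
qed

lemma reduced_operator_carrier:
  assumes "V \<in> carrier_mat n k"
  shows "reduced_operator A V \<tau> \<in> carrier_mat k k"
  using assms by auto

lemma selfadjoint_reduced_operator:
  assumes sa: "selfadjoint n A" and V: "V \<in> carrier_mat n k" and orth: "orthonormal_columns V"
  shows "selfadjoint k (reduced_operator A V \<tau>)"
  unfolding selfadjoint_def
proof (intro conjI ballI)
  note A = selfadjoint_carrier[OF sa]
  show M: "reduced_operator A V \<tau> \<in> carrier_mat k k" using V by (rule reduced_operator_carrier)
  fix y w :: "real vec" assume y: "y \<in> carrier_vec k" and w: "w \<in> carrier_vec k"
  let ?a = "A *\<^sub>v (V *\<^sub>v y)" and ?b = "A *\<^sub>v (V *\<^sub>v w)"
  have Vy: "V *\<^sub>v y \<in> carrier_vec n" and Vw: "V *\<^sub>v w \<in> carrier_vec n" using V y w by simp_all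
  then have a: "?a \<in> carrier_vec n" and b: "?b \<in> carrier_vec n" using A by simp_all
  have 1: "(V *\<^sub>v w) \<bullet> ?a = (V *\<^sub>v y) \<bullet> ?b"
    using selfadjointD[OF sa Vy Vw] comm_scalar_prod[OF Vw a] by simp
  have 2: "?b \<bullet> (fine_projection V *\<^sub>v ?a) = ?a \<bullet> (fine_projection V *\<^sub>v ?b)"
    unfolding scalar_prod_fine_projection[OF V a b] scalar_prod_fine_projection[OF V b a]
    using V a b by (simp add: comm_scalar_prod[of ?b n] comm_scalar_prod[of "transpose_mat V *\<^sub>v ?b" k])
  have "(reduced_operator A V \<tau> *\<^sub>v y) \<bullet> w = w \<bullet> (reduced_operator A V \<tau> *\<^sub>v y)"
    using mult_mat_vec_carrier[OF M y] w by (rule comm_scalar_prod)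
  also have "\<dots> = y \<bullet> (reduced_operator A V \<tau> *\<^sub>v w)"
    unfolding reduced_operator_form[OF sa V orth y w] reduced_operator_form[OF sa V orth w y] 1 2 ..
  finally show "(reduced_operator A V \<tau> *\<^sub>v y) \<bullet> w = y \<bullet> (reduced_operator A V \<tau> *\<^sub>v w)" .
qed

section \<open>Nonpositivity of the largest eigenvalue\<close>

lemma real_eigenvalue_neg:
  assumes A: "A \<in> carrier_mat n n" and neg: "all_eigenvalues_real_negative A" and l: "l \<in> spectrum A"
  shows "l < 0"
proof -
  have A': "map_mat complex_of_real A \<in> carrier_mat n n" using A by simp
  have "poly (char_poly A) l = 0" using l spectrum_root_char_poly[OF A] by simp
  then have "poly (char_poly (map_mat complex_of_real A)) (complex_of_real l) = 0"
    by (simp add: of_real_hom.char_poly_hom[OF A])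
  then have "complex_of_real l \<in> spectrum (map_mat complex_of_real A)"
    using spectrum_root_char_poly[OF A'] by simp
  then show ?thesis using neg unfolding all_eigenvalues_real_negative_def by fastforce
qed

theorem corollary5p1:
  fixes N K :: nat
    and A V :: "real mat"
    and R :: "real vec \<Rightarrow> real vec"
    and \<tau> \<gamma>\<^sub>1 \<gamma>\<^sub>N :: real
  assumes "0 < K" and "K \<le> N"
    and "A \<in> carrier_mat N N"
    and "V \<in> carrier_mat N K"
    and "orthonormal_columns V"
    and "\<And>u. u \<in> carrier_vec N \<Longrightarrow> R u = A *\<^sub>v u"
    and "mat_adjoint A = A"
    and "all_eigenvalues_real_negative A"
    and "\<gamma>\<^sub>1 = largest_eigenvalue A"
    and "\<gamma>\<^sub>N = smallest_eigenvalue A"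
    and "0 \<le> \<tau>"
    and "\<tau> \<le> \<bar>\<gamma>\<^sub>1\<bar> / \<gamma>\<^sub>N\<^sup>2"
  shows "largest_eigenvalue (transpose_mat V * P_A A V \<tau> * A * V) \<le> 0"
proof -
  note A = assms(3) and V = assms(4) and orth = assms(5)
  let ?M = "reduced_operator A V \<tau>" and ?F = "fine_projection V"
  have sa: "selfadjoint N A" using assms by (intro selfadjoint_if_mat_adjoint_eq)
  have fin: "finite (spectrum A)" using card_finite_spectrum[OF A] by simp
  have ne: "spectrum A \<noteq> {}" using assms by (intro selfadjoint_spectrum_nonempty[OF sa]) simp
  have \<gamma>: "\<gamma>\<^sub>N \<le> l" "l \<le> \<gamma>\<^sub>1" if "l \<in> spectrum A" for l
    using that fin assms(9,10) by (simp_all add: largest_eigenvalue_def smallest_eigenvalue_def)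
  have "\<gamma>\<^sub>1 \<in> spectrum A"
    using fin ne assms(9) by (simp add: largest_eigenvalue_def)
  then have \<gamma>1: "\<gamma>\<^sub>1 < 0" and \<gamma>N: "\<gamma>\<^sub>N \<le> \<gamma>\<^sub>1"
    using real_eigenvalue_neg[OF A assms(8)] \<gamma>(1) by auto
  have sq: "l\<^sup>2 \<le> \<gamma>\<^sub>N\<^sup>2" if "l \<in> spectrum A" for l
    using power_mono[of "- l" "- \<gamma>\<^sub>N" 2] \<gamma>[OF that] \<gamma>1 by simp
  have \<tau>: "\<tau> * \<gamma>\<^sub>N\<^sup>2 \<le> - \<gamma>\<^sub>1"
    using mult_right_mono[OF assms(12), of "\<gamma>\<^sub>N\<^sup>2"] \<gamma>1 \<gamma>N by simp
  have M: "?M \<in> carrier_mat K K" and saM: "selfadjoint K ?M"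
    using reduced_operator_carrier[OF V] selfadjoint_reduced_operator[OF sa V orth] by auto
  have "l \<le> 0" if l: "l \<in> spectrum ?M" for l
  proof -
    obtain y where y: "y \<in> carrier_vec K" "y \<noteq> 0\<^sub>v K" "?M *\<^sub>v y = l \<cdot>\<^sub>v y"
      using l M unfolding spectrum_def eigenvalue_def eigenvector_def by auto
    define x where "x = V *\<^sub>v y"
    define a where "a = A *\<^sub>v x"
    have x: "x \<in> carrier_vec N" using V y by (simp add: x_def)
    have a: "a \<in> carrier_vec N" using A x by (simp add: a_def)
    have "l * (y \<bullet> y) = y \<bullet> (?M *\<^sub>v y)" using y by simp
    also have "\<dots> = x \<bullet> a + \<tau> * (a \<bullet> (?F *\<^sub>v a))"
      unfolding x_def a_def by (rule reduced_operator_form[OF sa V orth y(1) y(1)])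
    also have "\<dots> \<le> \<gamma>\<^sub>1 * (x \<bullet> x) + \<tau> * (\<gamma>\<^sub>N\<^sup>2 * (x \<bullet> x))"
    proof (intro add_mono mult_left_mono)
      show "x \<bullet> a \<le> \<gamma>\<^sub>1 * (x \<bullet> x)"
        unfolding a_def using \<gamma>(2) by (rule selfadjoint_rayleigh_le[OF sa x])
      have "a \<bullet> (?F *\<^sub>v a) \<le> a \<bullet> a"
        unfolding scalar_prod_fine_projection[OF V a a]
        using scalar_prod_self_nonneg[of "transpose_mat V *\<^sub>v a"] by linarith
      also have "\<dots> \<le> \<gamma>\<^sub>N\<^sup>2 * (x \<bullet> x)"
        unfolding a_def using sq by (rule selfadjoint_norm_sq_le[OF sa x])
      finally show "a \<bullet> (?F *\<^sub>v a) \<le> \<gamma>\<^sub>N\<^sup>2 * (x \<bullet> x)" .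
    qed (use assms in auto)
    also have "\<dots> = (\<gamma>\<^sub>1 + \<tau> * \<gamma>\<^sub>N\<^sup>2) * (x \<bullet> x)" by (simp add: algebra_simps)
    also have "\<dots> \<le> 0"
      using \<tau> scalar_prod_self_nonneg[of x] by (intro mult_nonpos_nonneg) auto
    finally have "l * (y \<bullet> y) \<le> 0" .
    moreover have "0 < y \<bullet> y"
      using y scalar_prod_self_nonneg[of y] scalar_prod_self_eq_0_iff[OF y(1)] by simp
    ultimately show "l \<le> 0" by (simp add: mult_le_0_iff)
  qed
  moreover have "finite (spectrum ?M)" using card_finite_spectrum[OF M] by simp
  moreover have "spectrum ?M \<noteq> {}" using selfadjoint_spectrum_nonempty[OF saM assms(1)] .
  ultimately show ?thesis unfolding largest_eigenvalue_def by simp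
qed

end
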